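(* Let $Q^T\tau$ be a system of contrasts of $v$ treatments, $Q=(q_{i,k})$. Then the $A$-optimal treatment proportions for $Q^T\tau$ are given by $$w_i^*=\frac{\sqrt{\sum_k q_{i,k}^2}}{\sum_j\sqrt{\sum_k q_{j,k}^2}},\qquad i=1,\ldots,v.$$ In particular, if $Q^T\tau$ is a system of pairwise comparisons, the $A$-optimal treatment proportions are $$w_i^*=\frac{\sqrt{d_i}}{\sum_j\sqrt{d_j}},\qquad i=1,\ldots,v,$$ where $d_i$ is the degree of the $i$-th vertex in the corresponding graph $G$.
   Context: A system of $s$ contrasts $Q^T\tau$ is given by a real $v\times s$ matrix $Q$ with $Q^T1_v=0_s$ and with no zero row. A design (treatment proportions) is $w=(w_1,\ldots,w_v)^T$ with $w_i\in[0,1]$, $\sum_iw_i=1$; it is feasible if and only if $w_i>0$ for all $i$ (written $w>0$). $V_Q(w)=Q^T\mathrm{diag}(w)^{-1}Q$ and $\Psi_{-1}(w)=\mathrm{tr}(V_Q(w))$; a design is $A$-optimal for $Q^T\tau$ if it minimizes $\Psi_{-1}(w)$ over all designs $w>0$. $Q^T\tau$ is a system of pairwise comparisons if every column of $Q$ represents a difference $\tau_j-\tau_i$ with $i\ne j$ (entry $1$ in row $j$, $-1$ in row $i$, zeros elsewhere), different columns corresponding to different unordered pairs. The corresponding graph $G$ has vertex set $\{1,\ldots,v\}$ and an edge $(j,i)$ for each comparison $\tau_j-\tau_i$ in the system; $d_i$ is the number of edges incident with $i$. *)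

theory Defs
  imports "HOL-Analysis.Analysis"
begin

text \<open>
  The treatments are the elements of the finite index type \<open>'v\<close> and the contrasts are indexed by
  \<open>'s\<close>; a \<open>v \<times> s\<close> coefficient matrix \<open>Q\<close> thus has type \<open>real^'s^'v\<close>, and its entry \<open>q\<^sub>i\<^sub>k\<close> is
  \<open>Q $ i $ k\<close>.
\<close>

definition contrast_system :: "real^'s^'v \<Rightarrow> bool" where
  "contrast_system Q \<longleftrightarrow> transpose Q *v 1 = 0 \<and> (\<forall>i. row i Q \<noteq> 0)"

definition design :: "real^'v \<Rightarrow> bool" where
  "design w \<longleftrightarrow> (\<forall>i. w $ i \<in> {0..1}) \<and> (\<Sum>i\<in>UNIV. w $ i) = 1"

definition feasible :: "real^'v \<Rightarrow> bool" where
  "feasible w \<longleftrightarrow> (\<forall>i. w $ i > 0)"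

definition diag_matrix :: "real^'v \<Rightarrow> real^'v^'v" where
  "diag_matrix w = (\<chi> i j. if i = j then w $ i else 0)"

definition V_matrix :: "real^'s^'v \<Rightarrow> real^'v \<Rightarrow> real^'s^'s" where
  "V_matrix Q w = transpose Q ** matrix_inv (diag_matrix w) ** Q"

definition A_criterion :: "real^'s^'v \<Rightarrow> real^'v \<Rightarrow> real" where
  "A_criterion Q w = trace (V_matrix Q w)"

definition A_optimal :: "real^'s^'v \<Rightarrow> real^'v \<Rightarrow> bool" where
  "A_optimal Q w \<longleftrightarrow> is_arg_min (A_criterion Q) (\<lambda>u. design u \<and> feasible u) w"

text \<open>The vector \<open>q\<close> is the coefficient vector of the difference \<open>\<tau>\<^sub>j - \<tau>\<^sub>i\<close>.\<close>

definition difference_vector :: "real^'v \<Rightarrow> 'v \<Rightarrow> 'v \<Rightarrow> bool" where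
  "difference_vector q j i \<longleftrightarrow>
     i \<noteq> j \<and> q $ j = 1 \<and> q $ i = -1 \<and> (\<forall>l. l \<noteq> i \<longrightarrow> l \<noteq> j \<longrightarrow> q $ l = 0)"

definition pairwise_comparisons :: "real^'s^'v \<Rightarrow> bool" where
  "pairwise_comparisons Q \<longleftrightarrow>
     (\<forall>k. \<exists>j i. difference_vector (column k Q) j i) \<and>
     (\<forall>k k' j i j' i'. k \<noteq> k' \<longrightarrow> difference_vector (column k Q) j i \<longrightarrow>
        difference_vector (column k' Q) j' i' \<longrightarrow> {j, i} \<noteq> {j', i'})"

text \<open>
  The graph of a system of pairwise comparisons has all of \<open>'v\<close> as its vertex set; edges are
  unordered pairs, represented as two-element sets.
\<close>

definition comparison_edges :: "real^'s^'v \<Rightarrow> 'v set set" where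
  "comparison_edges Q = {{j, i} | j i. \<exists>k. difference_vector (column k Q) j i}"

definition vertex_degree :: "'v set set \<Rightarrow> 'v \<Rightarrow> nat" where
  "vertex_degree E i = card {e \<in> E. i \<in> e}"

end

theory Submission
  imports Defs
begin

text \<open>
  Let \<open>a\<^sub>i\<close> be the norm of the \<open>i\<close>-th row of \<open>Q\<close> and let \<open>S\<close> be the sum of these norms. The criterion
  is \<open>\<Sum>\<^sub>i a\<^sub>i\<^sup>2 / w\<^sub>i\<close>, and since the \<open>w\<^sub>i\<close> sum to 1, completing the square turns it into
  \<open>S\<^sup>2 + \<Sum>\<^sub>i (a\<^sub>i - S w\<^sub>i)\<^sup>2 / w\<^sub>i\<close>, which is least exactly for \<open>w\<^sub>i = a\<^sub>i / S\<close>. For pairwise comparisons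
  the columns are in bijection with the edges through their supports, so \<open>a\<^sub>i\<^sup>2 = d\<^sub>i\<close>.
\<close>

lemma matrix_inv_diag_matrix:
  fixes w :: "real^'v"
  assumes "feasible w"
  shows "matrix_inv (diag_matrix w) = diag_matrix (\<chi> i. 1 / w $ i)"
proof -
  have nz: "w $ i \<noteq> 0" for i
    using assms unfolding feasible_def by (metis less_irrefl)
  have *: "diag_matrix w ** diag_matrix (\<chi> i. 1 / w $ i) = mat 1"
    using nz by (simp add: vec_eq_iff matrix_matrix_mult_def diag_matrix_def mat_def
        if_distrib[where f="\<lambda>x. x * _"] cong: if_cong)
  \<comment> \<open>\<open>matrix_inv\<close> chooses some two-sided inverse. One exists because a
    right inverse of a square matrix is also a left inverse; associativity then identifies the
    chosen one with the right inverse in \<open>*\<close>.\<close>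
  have "matrix_inv (diag_matrix w) ** diag_matrix w = mat 1"
    unfolding matrix_inv_def using * matrix_left_right_inverse by (metis (mono_tags, lifting) someI_ex)
  then show ?thesis
    using * by (metis matrix_mul_assoc matrix_mul_lid matrix_mul_rid)
qed

lemma norm_row_eq: "norm (row i Q) = sqrt (\<Sum>k\<in>UNIV. (Q $ i $ k)\<^sup>2)" for Q :: "real^'s^'v"
  by (simp add: norm_vec_def L2_set_def row_def)

lemma A_criterion_eq:
  fixes Q :: "real^'s^'v"
  assumes "feasible w"
  shows "A_criterion Q w = (\<Sum>i\<in>UNIV. (norm (row i Q))\<^sup>2 / w $ i)"
proof -
  have "A_criterion Q w = (\<Sum>k\<in>UNIV. \<Sum>i\<in>UNIV. (Q $ i $ k)\<^sup>2 / w $ i)"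
    by (simp add: A_criterion_def V_matrix_def matrix_inv_diag_matrix[OF assms] trace_def,
       simp add: matrix_matrix_mult_def diag_matrix_def transpose_def power2_eq_square
        if_distrib[where f="\<lambda>x. _ * x"] mult.assoc cong: if_cong)
  also have "\<dots> = (\<Sum>i\<in>UNIV. \<Sum>k\<in>UNIV. (Q $ i $ k)\<^sup>2 / w $ i)"
    by (rule sum.swap)
  also have "\<dots> = (\<Sum>i\<in>UNIV. (norm (row i Q))\<^sup>2 / w $ i)"
    by (simp add: norm_row_eq sum_nonneg sum_divide_distrib)
  finally show ?thesis .
qed

text \<open>Cauchy-Schwarz with its defect made explicit. Expanding the squares, the cross terms
  give \<open>- 2 * S * S\<close> and the last terms give \<open>S\<^sup>2\<close> because the
  weights sum to 1.\<close>

lemma sum_square_divide_eq: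
  fixes a w :: "'i \<Rightarrow> real"
  assumes "\<And>i. i \<in> I \<Longrightarrow> w i \<noteq> 0" "sum w I = 1"
  shows "(\<Sum>i\<in>I. (a i)\<^sup>2 / w i) = (sum a I)\<^sup>2 + (\<Sum>i\<in>I. (a i - sum a I * w i)\<^sup>2 / w i)"
proof -
  define S where "S = sum a I"
  have "(\<Sum>i\<in>I. (a i - S * w i)\<^sup>2 / w i) = (\<Sum>i\<in>I. (a i)\<^sup>2 / w i - 2 * S * a i + S\<^sup>2 * w i)"
    using assms(1) by (intro sum.cong) (auto simp: field_simps power2_eq_square)
  also have "\<dots> = (\<Sum>i\<in>I. (a i)\<^sup>2 / w i) - 2 * S * S + S\<^sup>2 * sum w I"
    by (simp add: sum.distrib sum_subtractf sum_distrib_left S_def)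
  finally show ?thesis
    using assms(2) by (simp add: S_def power2_eq_square)
qed

text \<open>Nonzero rows make the candidate feasible, so the bound \<open>S\<^sup>2\<close> is
  attained. Any other feasible design has a positive defect \<open>r\<close>, which yields
  uniqueness.\<close>

lemma A_optimal_iff:
  fixes Q :: "real^'s^'v"
  assumes "\<And>i. row i Q \<noteq> 0"
  shows "A_optimal Q w \<longleftrightarrow> w = (\<chi> i. norm (row i Q) / (\<Sum>j\<in>UNIV. norm (row j Q)))"
proof -
  define S where "S = (\<Sum>j\<in>UNIV. norm (row j Q))"
  define w0 where "w0 = (\<chi> i. norm (row i Q) / S)"
  define r where "r u = (\<Sum>i\<in>UNIV. (norm (row i Q) - S * u $ i)\<^sup>2 / u $ i)" for u
  have S: "S > 0"
    unfolding S_def using assms by (intro sum_pos) auto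
  \<comment> \<open>This gives the upper bound 1 on the proportions that \<open>design\<close>
    demands.\<close>
  have le: "norm (row i Q) \<le> S" for i
    unfolding S_def by (intro member_le_sum) auto
  have feas0: "feasible w0"
    using S assms by (simp add: feasible_def w0_def)
  have design0: "design w0"
    using S le by (auto simp: design_def w0_def S_def simp flip: sum_divide_distrib)
  have crit: "A_criterion Q u = S\<^sup>2 + r u" if "design u" "feasible u" for u
  proof -
    have "u $ i \<noteq> 0" for i
      using that(2) unfolding feasible_def by (metis less_irrefl)
    then show ?thesis
      unfolding A_criterion_eq[OF that(2)] S_def r_def using that(1)
      by (intro sum_square_divide_eq) (auto simp: design_def)
  qed
  have r_nonneg: "r u \<ge> 0" if "feasible u" for u
    unfolding r_def using that by (intro sum_nonneg divide_nonneg_pos) (auto simp: feasible_def)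
  have r_zero: "r u = 0 \<longleftrightarrow> u = w0" if "feasible u" for u
  proof -
    have pos: "u $ i > 0" for i
      using that by (simp add: feasible_def)
    have "r u = 0 \<longleftrightarrow> (\<forall>i. (norm (row i Q) - S * u $ i)\<^sup>2 / u $ i = 0)"
      unfolding r_def using pos
      by (subst sum_nonneg_eq_0_iff) (auto intro: divide_nonneg_pos)
    also have "\<dots> \<longleftrightarrow> u = w0"
      using S pos[THEN less_imp_neq] by (auto simp: vec_eq_iff w0_def field_simps)
    finally show ?thesis .
  qed
  have "A_optimal Q w \<longleftrightarrow> w = w0"
  proof
    assume opt: "A_optimal Q w"
    then have w: "design w" "feasible w"
      by (auto simp: A_optimal_def is_arg_min_def)
    \<comment> \<open>Optimality is tested against \<open>w0\<close> alone: \<open>r w0 = 0\<close>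
      and \<open>r w \<ge> 0\<close> force \<open>r w = 0\<close>.\<close>
    have "r w \<le> r w0"
      using opt design0 feas0 crit[OF w] crit[OF design0 feas0]
      by (auto simp: A_optimal_def is_arg_min_linorder)
    then show "w = w0"
      using r_zero[OF feas0] r_zero[OF w(2)] r_nonneg[OF w(2)] by simp
  next
    assume "w = w0"
    then show "A_optimal Q w"
      using design0 feas0 crit r_zero[OF feas0] r_nonneg
      by (auto simp: A_optimal_def is_arg_min_linorder)
  qed
  then show ?thesis
    by (simp add: w0_def S_def)
qed

lemma difference_vector_support:
  "difference_vector q j i \<Longrightarrow> {l. q $ l \<noteq> 0} = {j, i}"
  by (auto simp: difference_vector_def)

text \<open>Squared entries are 0 or 1, so the row sum counts the columns whose support contains
  \<open>i\<close>. Taking supports maps these columns bijectively onto the edges at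
  \<open>i\<close>.\<close>

lemma vertex_degree_comparison_edges:
  fixes Q :: "real^'s^'v"
  assumes "pairwise_comparisons Q"
  shows "real (vertex_degree (comparison_edges Q) i) = (\<Sum>k\<in>UNIV. (Q $ i $ k)\<^sup>2)"
proof -
  \<comment> \<open>The edge of column \<open>k\<close>, taken as its support so that no endpoints
    or orientation need to be chosen.\<close>
  define s where "s k = {l. column k Q $ l \<noteq> 0}" for k
  have col: "\<exists>j i. difference_vector (column k Q) j i" for k
    using assms by (simp add: pairwise_comparisons_def)
  have s_eq: "s k = {j, i}" if "difference_vector (column k Q) j i" for k j i
    using difference_vector_support[OF that] by (simp add: s_def)
  have edges: "comparison_edges Q = range s"
  proof
    show "comparison_edges Q \<subseteq> range s"
      by (auto simp: comparison_edges_def simp flip: s_eq)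
    show "range s \<subseteq> comparison_edges Q"
    proof (rule image_subsetI)
      fix k
      obtain j i where "difference_vector (column k Q) j i"
        using col by meson
      then show "s k \<in> comparison_edges Q"
        using s_eq[of k j i] by (auto simp: comparison_edges_def)
    qed
  qed
  \<comment> \<open>The support forgets the sign of a comparison, so this relies on distinct columns
    having distinct unordered pairs.\<close>
  have "inj s"
  proof (rule injI, rule ccontr)
    fix k k' assume "s k = s k'" "k \<noteq> k'"
    moreover obtain j i j' i' where "difference_vector (column k Q) j i"
        "difference_vector (column k' Q) j' i'"
      using col by meson
    ultimately show False
      using assms s_eq unfolding pairwise_comparisons_def by metis
  qed
  have sq: "(Q $ i $ k)\<^sup>2 = of_bool (i \<in> s k)" for k
  proof -
    obtain j l where "difference_vector (column k Q) j l"
      using col by blast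
    then show ?thesis
      by (cases "i = j \<or> i = l") (auto simp: difference_vector_def column_def s_def)
  qed
  have "{e \<in> range s. i \<in> e} = s ` {k. i \<in> s k}"
    by blast
  then have "vertex_degree (comparison_edges Q) i = card {k. i \<in> s k}"
    using \<open>inj s\<close> by (simp add: vertex_degree_def edges card_image inj_on_subset)
  then show ?thesis
    by (simp add: sq)
qed

theorem proposition5:
  fixes Q :: "real^'s^'v"
  assumes "contrast_system Q"
  shows "(\<forall>w. A_optimal Q w \<longleftrightarrow>
            w = (\<chi> i. sqrt (\<Sum>k\<in>UNIV. (Q $ i $ k)\<^sup>2) /
                      (\<Sum>j\<in>UNIV. sqrt (\<Sum>k\<in>UNIV. (Q $ j $ k)\<^sup>2)))) \<and>
         (pairwise_comparisons Q \<longrightarrow>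
           (\<forall>w. A_optimal Q w \<longleftrightarrow>
             w = (\<chi> i. sqrt (real (vertex_degree (comparison_edges Q) i)) /
                       (\<Sum>j\<in>UNIV. sqrt (real (vertex_degree (comparison_edges Q) j))))))"
proof -
  have "A_optimal Q w \<longleftrightarrow> w = (\<chi> i. sqrt (\<Sum>k\<in>UNIV. (Q $ i $ k)\<^sup>2) /
      (\<Sum>j\<in>UNIV. sqrt (\<Sum>k\<in>UNIV. (Q $ j $ k)\<^sup>2)))" for w
    using assms A_optimal_iff[of Q w] by (simp add: contrast_system_def norm_row_eq)
  then show ?thesis
    by (simp add: vertex_degree_comparison_edges)
qed

end
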